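(* Fix $\varepsilon>0$. Consider solution pairs $(\lambda,u)$ of $$\left(\frac{u'}{\sqrt{1+\varepsilon^2(u')^2}}\right)'=\frac{\lambda}{(1+u)^2},\quad 0<x<1;\qquad u'(0)=u(1)=0,$$ lying on the maximal (upper) solution branch, parameterized by $\delta := 1+u(0)$ as $\delta\to0^+$. Then $\lambda=\lambda(\delta)$ has the three-term asymptotic expansion $$\lambda=\delta\lambda_1-(\delta^2\log\delta)\,\lambda_1+\delta^2\lambda_1\left(\log\left(4-2\varepsilon^2\lambda_1\right)-\frac{1}{1+\varepsilon^2}\right)+o(\delta^2)\qquad\text{as }\delta\to0^+,$$ where $$\lambda_1=\frac{\sqrt{1+\varepsilon^2}-1}{\varepsilon^2\sqrt{1+\varepsilon^2}}.$$
   Context: Here $\lambda>0$ and solutions are classical, with $u>-1$ on $[0,1]$. The "maximal (upper) solution branch as $\delta\to0^+$" means the solution pairs $(\lambda,u)$ with $u(0)=-1+\delta$ and $\delta>0$ small: for each small $\delta>0$, $\lambda(\delta)$ is the value of $\lambda$ for which the problem has a solution with $1+u(0)=\delta$, and the claim describes the behavior of $\lambda(\delta)$ as $\delta\to0^+$ with $\varepsilon$ fixed. *)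

theory Defs
  imports "HOL-Analysis.Analysis" "HOL-Library.Landau_Symbols"
begin

(* Classical solutions, i.e. u in C^1[0,1] and C^2(0,1); du and ddu are u' and u''.
   Derivatives at 0 and 1 are one-sided. Only the values of u on [0,1] matter. *)
definition is_solution :: "real \<Rightarrow> real \<Rightarrow> (real \<Rightarrow> real) \<Rightarrow> bool" where
  "is_solution \<epsilon> lam u \<longleftrightarrow>
     lam > 0 \<and> (\<forall>x\<in>{0..1}. u x > -1) \<and>
     (\<exists>du ddu.
        (\<forall>x\<in>{0..1}. (u has_real_derivative du x) (at x within {0..1})) \<and>
        continuous_on {0..1} du \<and>
        (\<forall>x\<in>{0<..<1}. (du has_real_derivative ddu x) (at x)) \<and>
        continuous_on {0<..<1} ddu \<and>
        (\<forall>x\<in>{0<..<1}.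
           ((\<lambda>y. du y / sqrt (1 + \<epsilon>\<^sup>2 * (du y)\<^sup>2))
              has_real_derivative lam / (1 + u x)\<^sup>2) (at x)) \<and>
        du 0 = 0 \<and> u 1 = 0)"

definition on_branch :: "real \<Rightarrow> real \<Rightarrow> real \<Rightarrow> bool" where
  "on_branch \<epsilon> \<delta> lam \<longleftrightarrow> (\<exists>u. is_solution \<epsilon> lam u \<and> 1 + u 0 = \<delta>)"

(* Only meaningful when exactly one such value exists. *)
definition branch_lambda :: "real \<Rightarrow> real \<Rightarrow> real" where
  "branch_lambda \<epsilon> \<delta> = (THE lam. on_branch \<epsilon> \<delta> lam)"

definition lambda1 :: "real \<Rightarrow> real" where
  "lambda1 \<epsilon> = (sqrt (1 + \<epsilon>\<^sup>2) - 1) / (\<epsilon>\<^sup>2 * sqrt (1 + \<epsilon>\<^sup>2))"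

end

(* With w = 1 + u, the first integral of the equation is
     1 / sqrt (1 + eps^2 w'^2) = a + (1 - a) delta / w,   where lam = delta (1 - a) / eps^2.
   Hence x is an explicit function of w, depending on a and delta, and the condition u(1) = 0 says
   that this function takes the value 1 at w = 1. That value is strictly increasing in a, so at most
   one a is possible. Inserting a = a0 - (1 - a0) delta (L - ln delta) + n delta into the closed form,
   the value at w = 1 is 1 + n C delta + o(delta) with C > 0. Taking n of either sign and arbitrarily
   small traps the solution a between the two trial values, which gives both its existence and the
   expansion of lam. *)
theory Submission
  imports Defs "HOL-Real_Asymp.Real_Asymp"
begin

section \<open>The time map: derivative in the height \<open>w\<close>, monotonicity in the
  parameter \<open>a\<close>\<close>

text \<open>The position \<open>x\<close> at which the solution with parameters \<open>\<delta>\<close> and \<open>a\<close> reaches \<open>1 + u x = w\<close>.\<close>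
definition time_map :: "real \<Rightarrow> real \<Rightarrow> real \<Rightarrow> real \<Rightarrow> real" where
  "time_map \<epsilon> \<delta> a w =
     (let y = (1 + a) * w / \<delta> - a
      in \<epsilon> * \<delta> / ((1 + a) * sqrt (1 - a\<^sup>2)) * (a * sqrt (y\<^sup>2 - 1) + arcosh y))"

lemma one_minus_square_pos: "-1 < a \<Longrightarrow> a < 1 \<Longrightarrow> 0 < 1 - a\<^sup>2" for a :: real
  by (simp add: abs_square_less_1)

lemma has_derivative_sqrt_comp:
  assumes "(f has_real_derivative 2 * D) (at x)" "0 < f x"
  shows "((\<lambda>x. sqrt (f x)) has_real_derivative D / sqrt (f x)) (at x)"
proof -
  have "((\<lambda>x. sqrt (f x)) has_real_derivative inverse (sqrt (f x)) / 2 * (2 * D)) (at x)"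
    by (rule DERIV_chain2[OF DERIV_real_sqrt[OF assms(2)] assms(1)])
  also have "inverse (sqrt (f x)) / 2 * (2 * D) = D / sqrt (f x)"
    using assms(2) by (simp add: field_simps)
  finally show ?thesis .
qed

lemma time_map_base [simp]: "\<delta> \<noteq> 0 \<Longrightarrow> time_map \<epsilon> \<delta> a \<delta> = 0"
  by (simp add: time_map_def)

text \<open>The endpoint \<open>w = \<delta>\<close>, where \<open>y = 1\<close>, is included: the
  derivative blows up there, and the monotonicity and constancy arguments below use only continuity
  at that point.\<close>

lemma continuous_on_time_map:
  assumes "-1 < a" "0 < \<delta>"
  shows "continuous_on {\<delta>..} (time_map \<epsilon> \<delta> a)"
proof -
  have "1 \<le> (1 + a) * w / \<delta> - a" if "\<delta> \<le> w" for w
    using mult_left_mono[OF that, of "1 + a"] assms by (simp add: field_simps)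
  then show ?thesis
    unfolding time_map_def Let_def
    using assms by (intro continuous_intros) auto
qed

text \<open>By the first integral, \<open>c\<close> is the value of
  \<open>1 / sqrt (1 + \<epsilon>^2 w'^2)\<close> at height \<open>w\<close>. Hence
  \<open>sqrt (1 - c^2) = \<epsilon> c w'\<close>, and the derivative is \<open>1 / w'\<close>, that
  is, dx/dw.\<close>

lemma time_map_has_derivative:
  assumes a: "-1 < a" "a < 1" and d: "0 < \<delta>" "\<delta> < w"
  defines "c \<equiv> a + (1 - a) * \<delta> / w"
  shows "(time_map \<epsilon> \<delta> a has_real_derivative \<epsilon> * (c / sqrt (1 - c\<^sup>2))) (at w)"
proof -
  define y where "y = (1 + a) * w / \<delta> - a"
  define S where "S = sqrt (y\<^sup>2 - 1)"
  have y: "1 < y"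
    using mult_strict_left_mono[OF d(2), of "1 + a"] a d by (simp add: y_def field_simps)
  then have S: "S > 0" and y2: "y\<^sup>2 - 1 > 0"
    by (simp_all add: S_def)
  have w: "w > 0" using d by simp
  have A: "0 < 1 - a\<^sup>2" using one_minus_square_pos a by blast
  \<comment> \<open>\<open>a * y + 1\<close> is the numerator of the derivative of
    \<open>a * sqrt (y^2 - 1) + arcosh y\<close>. It is a multiple of \<open>c\<close>, while
    \<open>1 - c^2\<close> is a multiple of \<open>y^2 - 1\<close>: factor by factor,
    \<open>1 - c\<close> matches \<open>y - 1\<close> and \<open>1 + c\<close> matches
    \<open>y + 1\<close>.\<close>
  have ay: "a * y + 1 = (1 + a) * (w / \<delta>) * c"
    using d w by (simp add: y_def c_def field_simps)
  have "y - 1 = (1 + a) * (w / \<delta> - 1)" "1 - c = (1 - a) * (\<delta> / w) * (w / \<delta> - 1)"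
    using d w by (simp_all add: c_def y_def field_simps)
  then have "1 - c = (1 - a) / (1 + a) * (\<delta> / w) * (y - 1)"
    using a by simp
  moreover have "1 + c = \<delta> / w * (y + 1)"
    using d w by (simp add: c_def y_def field_simps)
  moreover have "1 - c\<^sup>2 = (1 - c) * (1 + c)" "y\<^sup>2 - 1 = (y - 1) * (y + 1)"
    "1 - a\<^sup>2 = (1 - a) * (1 + a)"
    by (simp_all add: power2_eq_square algebra_simps)
  ultimately have "1 - c\<^sup>2 = (\<delta> / w / (1 + a))\<^sup>2 * ((1 - a\<^sup>2) * (y\<^sup>2 - 1))"
    by (simp only:) (use a in \<open>simp add: power2_eq_square mult_ac\<close>)
  then have c: "sqrt (1 - c\<^sup>2) = \<delta> / w / (1 + a) * (sqrt (1 - a\<^sup>2) * S)"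
    using a d w by (simp add: real_sqrt_mult S_def)
  have dy: "((\<lambda>w. (1 + a) * w / \<delta> - a) has_real_derivative (1 + a) / \<delta>) (at w)"
    using d by (auto intro!: derivative_eq_intros)
  have dG: "((\<lambda>y. a * sqrt (y\<^sup>2 - 1) + arcosh y) has_real_derivative (a * y + 1) / S) (at y)"
  proof -
    have "((\<lambda>y. y\<^sup>2 - 1) has_real_derivative 2 * y) (at y)"
      by (auto intro!: derivative_eq_intros)
    from has_derivative_sqrt_comp[OF this y2]
    have "((\<lambda>y. sqrt (y\<^sup>2 - 1)) has_real_derivative y / S) (at y)"
      unfolding S_def .
    moreover have "(arcosh has_real_derivative 1 / S) (at y)"
      unfolding S_def using y by (rule arcosh_real_has_field_derivative)
    ultimately have "((\<lambda>y. a * sqrt (y\<^sup>2 - 1) + arcosh y) has_real_derivative a * (y / S) + 1 / S) (at y)"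
      by (intro DERIV_add DERIV_cmult)
    then show ?thesis by (simp add: add_divide_distrib)
  qed
  have "(time_map \<epsilon> \<delta> a has_real_derivative
      \<epsilon> * \<delta> / ((1 + a) * sqrt (1 - a\<^sup>2)) * ((a * y + 1) / S * ((1 + a) / \<delta>))) (at w)"
    unfolding time_map_def[abs_def] Let_def
    by (intro DERIV_cmult DERIV_chain2[where f = "\<lambda>y. a * sqrt (y\<^sup>2 - 1) + arcosh y", OF _ dy])
      (fold y_def, rule dG)
  also have "\<epsilon> * \<delta> / ((1 + a) * sqrt (1 - a\<^sup>2)) * ((a * y + 1) / S * ((1 + a) / \<delta>))
      = \<epsilon> * (c / sqrt (1 - c\<^sup>2))"
  proof -
    have "1 + a \<noteq> 0" "\<delta> \<noteq> 0" "w \<noteq> 0" "S \<noteq> 0" "sqrt (1 - a\<^sup>2) \<noteq> 0"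
      using a d w S A by auto
    then show ?thesis
      unfolding ay c by (simp add: divide_simps)
  qed
  finally show ?thesis .
qed

text \<open>Serves to compare dx/dw for two parameters. With \<open>r = sqrt (1 - t^2)\<close> the
  derivative is \<open>(r + t^2 / r) / r^2\<close>, which is positive.\<close>

lemma div_sqrt_one_minus_square_strict_mono:
  fixes x y :: real
  assumes "-1 < x" "x < y" "y < 1"
  shows "x / sqrt (1 - x\<^sup>2) < y / sqrt (1 - y\<^sup>2)"
proof (rule DERIV_pos_imp_increasing[OF assms(2)])
  fix t assume t: "x \<le> t" "t \<le> y"
  define r where "r = sqrt (1 - t\<^sup>2)"
  have p: "0 < 1 - t\<^sup>2" using one_minus_square_pos[of t] t assms by simp
  then have r: "r > 0" "r * r = 1 - t\<^sup>2" by (simp_all add: r_def)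
  have "((\<lambda>t. 1 - t\<^sup>2) has_real_derivative 2 * - t) (at t)"
    by (auto intro!: derivative_eq_intros)
  from has_derivative_sqrt_comp[OF this p]
  have "((\<lambda>t. sqrt (1 - t\<^sup>2)) has_real_derivative - t / r) (at t)"
    unfolding r_def .
  from DERIV_divide[OF DERIV_ident this]
  have "((\<lambda>t. t / sqrt (1 - t\<^sup>2)) has_real_derivative (1 * r - t * (- t / r)) / (r * r)) (at t)"
    using p unfolding r_def by simp
  then have "((\<lambda>t. t / sqrt (1 - t\<^sup>2)) has_real_derivative (r + t * (t / r)) / (r * r)) (at t)"
    by simp
  moreover have "r + t * (t / r) > 0"
    using r by (simp add: add_pos_nonneg)
  ultimately show "\<exists>D. ((\<lambda>t. t / sqrt (1 - t\<^sup>2)) has_real_derivative D) (at t) \<and> 0 < D"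
    using r(1) by (metis divide_pos_pos mult_pos_pos)
qed

text \<open>Both time maps vanish at \<open>w = \<delta>\<close>, so it suffices to compare their
  derivatives in \<open>w\<close>. For \<open>w > \<delta>\<close> the quantity \<open>c\<close>, a
  weighted mean of \<open>a\<close> and 1, increases strictly with \<open>a\<close>, and dx/dw
  increases with \<open>c\<close>.\<close>

lemma time_map_strict_mono:
  assumes e: "0 < \<epsilon>" and ab: "-1 < a" "a < b" "b < 1" and d: "0 < \<delta>" "\<delta> < 1"
  shows "time_map \<epsilon> \<delta> a 1 < time_map \<epsilon> \<delta> b 1"
proof -
  let ?D = "\<lambda>w. time_map \<epsilon> \<delta> b w - time_map \<epsilon> \<delta> a w"
  have "?D \<delta> < ?D 1"
  proof (rule DERIV_pos_imp_increasing_open[OF d(2)])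
    fix w assume w: "\<delta> < w" "w < 1"
    define ca cb where "ca = a + (1 - a) * \<delta> / w" and "cb = b + (1 - b) * \<delta> / w"
    have q: "0 < \<delta> / w" "\<delta> / w < 1" using d w by simp_all
    have "cb - ca = (b - a) * (1 - \<delta> / w)" "1 - cb = (1 - b) * (1 - \<delta> / w)"
      "ca - a = (1 - a) * (\<delta> / w)"
      by (simp_all add: ca_def cb_def algebra_simps diff_divide_distrib)
    moreover have "0 < (b - a) * (1 - \<delta> / w)" "0 < (1 - b) * (1 - \<delta> / w)" "0 < (1 - a) * (\<delta> / w)"
      using q ab by (intro mult_pos_pos; linarith)+
    ultimately have "cb - ca > 0" "1 - cb > 0" "ca - a > 0"
      by presburger+
    then have "ca / sqrt (1 - ca\<^sup>2) < cb / sqrt (1 - cb\<^sup>2)"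
      using ab by (intro div_sqrt_one_minus_square_strict_mono) auto
    then have "0 < \<epsilon> * (cb / sqrt (1 - cb\<^sup>2)) - \<epsilon> * (ca / sqrt (1 - ca\<^sup>2))"
      using mult_strict_left_mono[OF _ e] by (simp only: diff_gt_0_iff_gt)
    moreover have "(?D has_real_derivative
        \<epsilon> * (cb / sqrt (1 - cb\<^sup>2)) - \<epsilon> * (ca / sqrt (1 - ca\<^sup>2))) (at w)"
      unfolding ca_def cb_def
      by (intro DERIV_diff time_map_has_derivative) (use ab d w in auto)
    ultimately show "\<exists>y. (?D has_real_derivative y) (at w) \<and> 0 < y" by blast
  next
    show "continuous_on {\<delta>..1} ?D"
      by (intro continuous_on_diff continuous_on_subset[OF continuous_on_time_map])
        (use ab d in auto)
  qed
  then show ?thesis using d by simp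
qed

lemma continuous_on_time_map_parameter:
  assumes "0 < \<delta>" "\<delta> < 1" "S \<subseteq> {-1<..<1}"
  shows "continuous_on S (\<lambda>a. time_map \<epsilon> \<delta> a 1)"
proof -
  have 1: "1 \<le> (1 + a) * 1 / \<delta> - a" "(1 + a) * sqrt (1 - a\<^sup>2) \<noteq> 0" if "a \<in> S" for a
  proof -
    have a: "-1 < a" "a < 1" using that assms by auto
    have "(1 + a) * \<delta> \<le> (1 + a) * 1" using a assms by (intro mult_left_mono) auto
    then show "1 \<le> (1 + a) * 1 / \<delta> - a" using assms by (simp add: field_simps)
    show "(1 + a) * sqrt (1 - a\<^sup>2) \<noteq> 0" using a one_minus_square_pos[OF a] by simp
  qed
  have "\<delta> \<noteq> 0" using assms by simp
  then show ?thesis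
    unfolding time_map_def Let_def by (intro continuous_intros; use 1 in blast)
qed

section \<open>From a solution to a root of the time map equation\<close>

text \<open>Integrating the first integral along the solution identifies \<open>x\<close> with the
  time map at \<open>1 + u x\<close>; at \<open>x = 1\<close>, where \<open>u\<close> vanishes, this
  is the equation for \<open>a\<close>. Uniqueness of \<open>lam\<close> is thereby reduced to
  uniqueness of \<open>a\<close>.\<close>

lemma is_solution_imp_time_map:
  assumes e: "0 < \<epsilon>" and sol: "is_solution \<epsilon> lam u" and d: "1 + u 0 = \<delta>" "\<delta> < 1 / 2"
  obtains a where "-1 < a" "a < 1" "lam = \<delta> * (1 - a) / \<epsilon>\<^sup>2" "time_map \<epsilon> \<delta> a 1 = 1"
proof -
  from sol obtain du ddu where lam: "lam > 0" and u_gt: "\<And>x. x \<in> {0..1} \<Longrightarrow> u x > -1"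
    and u': "\<And>x. x \<in> {0..1} \<Longrightarrow> (u has_real_derivative du x) (at x within {0..1})"
    and cdu: "continuous_on {0..1} du"
    and du': "\<And>x. x \<in> {0<..<1} \<Longrightarrow> (du has_real_derivative ddu x) (at x)"
    and ode: "\<And>x. x \<in> {0<..<1} \<Longrightarrow>
       ((\<lambda>y. du y / sqrt (1 + \<epsilon>\<^sup>2 * (du y)\<^sup>2)) has_real_derivative lam / (1 + u x)\<^sup>2) (at x)"
    and bc: "du 0 = 0" "u 1 = 0"
    unfolding is_solution_def by blast
  have d0: "\<delta> > 0" using u_gt[of 0] d by simp
  define S where "S = (\<lambda>x. sqrt (1 + \<epsilon>\<^sup>2 * (du x)\<^sup>2))"
  have S1: "1 + \<epsilon>\<^sup>2 * (du x)\<^sup>2 > 0" for x by (simp add: add_pos_nonneg)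
  have S: "S x > 0" for x using S1 by (simp add: S_def)
  have SS: "S x * S x = 1 + \<epsilon>\<^sup>2 * (du x)\<^sup>2" for x using S1[of x] by (simp add: S_def)
  have cS: "continuous_on {0..1} S" unfolding S_def by (intro continuous_intros cdu)
  have cu: "continuous_on {0..1} u" using u' by (rule DERIV_continuous_on)
  have u'_at: "(u has_real_derivative du x) (at x)" if "0 < x" "x < 1" for x
    using u'[of x] that by (simp add: at_within_Icc_at)
  have du_pos: "du x > 0" if x: "0 < x" "x < 1" for x
  proof -
    \<comment> \<open>The equation says that \<open>du / S\<close> has the positive derivative
      \<open>lam / (1 + u)^2\<close>, and this quotient vanishes at 0.\<close>
    have "du 0 / S 0 < du x / S x"
    proof (rule DERIV_pos_imp_increasing_open[OF x(1)])
      fix t assume t: "0 < t" "t < x"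
      have "1 + u t > 0" using u_gt[of t] t x by simp
      then show "\<exists>y. ((\<lambda>x. du x / S x) has_real_derivative y) (at t) \<and> 0 < y"
        using ode[of t] t x lam by (intro exI[of _ "lam / (1 + u t)\<^sup>2"]) (simp add: S_def)
    next
      show "continuous_on {0..x} (\<lambda>x. du x / S x)"
        by (rule continuous_on_subset[of "{0..1}"], intro continuous_intros cdu cS)
          (use S x in \<open>auto simp: less_imp_neq[symmetric]\<close>)
    qed
    then show ?thesis using bc S[of x] by (simp add: zero_less_divide_iff)
  qed
  have u_incr: "u 0 < u x" if x: "0 < x" "x \<le> 1" for x
  proof (rule DERIV_pos_imp_increasing_open[OF x(1)])
    show "\<exists>y. (u has_real_derivative y) (at t) \<and> 0 < y" if "0 < t" "t < x" for t
      using u'_at[of t] du_pos[of t] that x by auto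
    show "continuous_on {0..x} u" using cu by (rule continuous_on_subset) (use x in auto)
  qed
  \<comment> \<open>The conserved quantity \<open>1 / S - \<epsilon>^2 lam / (1 + u)\<close>,
    evaluated at \<open>x = 0\<close>, where \<open>S = 1\<close> and
    \<open>1 + u = \<delta>\<close>.\<close>
  define a where "a = 1 - \<epsilon>\<^sup>2 * lam / \<delta>"
  have a1: "a < 1" using e lam d0 by (simp add: a_def)
  have energy: "1 / S x = a + (1 - a) * \<delta> / (1 + u x)" if x: "0 < x" "x \<le> 1" for x
  proof -
    let ?E = "\<lambda>x. 1 / S x - \<epsilon>\<^sup>2 * lam / (1 + u x)"
    have "?E x = ?E 0"
    proof (rule DERIV_isconst_end[OF x(1), of ?E])
      show "continuous_on {0..x} ?E"
      proof (rule continuous_on_subset[of "{0..1}"])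
        show "continuous_on {0..1} ?E"
          by (intro continuous_intros cS cu) (use S u_gt in \<open>force simp: less_imp_neq[symmetric]\<close>)+
      qed (use x in auto)
    next
      fix t assume t: "0 < t" "t < x"
      then have t1: "t \<in> {0<..<1}" using x by auto
      have ut: "1 + u t > 0" using u_gt[of t] t x by simp
      have dS: "(S has_real_derivative \<epsilon>\<^sup>2 * du t * ddu t / S t) (at t)"
      proof -
        have "((\<lambda>x. 1 + \<epsilon>\<^sup>2 * (du x)\<^sup>2) has_real_derivative 2 * (\<epsilon>\<^sup>2 * du t * ddu t)) (at t)"
          by (auto intro!: derivative_eq_intros du'[OF t1])
        from has_derivative_sqrt_comp[OF this S1]
        show ?thesis unfolding S_def .
      qed
      \<comment> \<open>The quotient rule is compared with the equation; since
        \<open>S^2 - \<epsilon>^2 du^2 = 1\<close>, the result is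
        \<open>ddu / S^3 = lam / (1 + u)^2\<close>, which makes the derivative of \<open>?E\<close>
        vanish.\<close>
      have "((\<lambda>y. du y / S y) has_real_derivative
          (ddu t * S t - du t * (\<epsilon>\<^sup>2 * du t * ddu t / S t)) / (S t * S t)) (at t)"
        using S[of t] by (intro DERIV_divide du'[OF t1] dS) auto
      then have "lam / (1 + u t)\<^sup>2 = (ddu t * S t - du t * (\<epsilon>\<^sup>2 * du t * ddu t / S t)) / (S t * S t)"
        using ode[OF t1] by (intro DERIV_unique) (simp_all add: S_def)
      also have "ddu t * S t - du t * (\<epsilon>\<^sup>2 * du t * ddu t / S t)
          = ddu t * (S t * S t - \<epsilon>\<^sup>2 * (du t)\<^sup>2) / S t"
        using S[of t] by (simp add: field_simps power2_eq_square)
      also have "\<dots> = ddu t / S t" by (simp add: SS)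
      finally have key: "lam / (1 + u t)\<^sup>2 = ddu t / S t / (S t * S t)" .
      have "(?E has_real_derivative
         - (\<epsilon>\<^sup>2 * du t * ddu t / S t) / (S t * S t) + \<epsilon>\<^sup>2 * lam * du t / (1 + u t)\<^sup>2) (at t)"
        by (rule derivative_eq_intros dS u'_at refl | use S[of t] ut t x in \<open>simp add: power2_eq_square\<close>)+
      also have "- (\<epsilon>\<^sup>2 * du t * ddu t / S t) / (S t * S t) + \<epsilon>\<^sup>2 * lam * du t / (1 + u t)\<^sup>2
         = \<epsilon>\<^sup>2 * du t * (lam / (1 + u t)\<^sup>2 - ddu t / S t / (S t * S t))"
        by (simp add: algebra_simps)
      also have "\<dots> = 0" using key by simp
      finally show "(?E has_real_derivative 0) (at t)" .
    qed
    moreover have "S 0 = 1" using bc by (simp add: S_def)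
    moreover have "\<epsilon>\<^sup>2 * lam = (1 - a) * \<delta>" using d0 by (simp add: a_def)
    ultimately show ?thesis using d d0 by simp
  qed
  have am1: "-1 < a"
  proof (rule ccontr)
    \<comment> \<open>Here \<open>\<delta> < 1 / 2\<close> enters: the first integral at
      \<open>x = 1\<close> gives \<open>a (1 - \<delta>) + \<delta> > 0\<close>, whereas
      \<open>a \<le> -1\<close> would bound the left side by
      \<open>2 \<delta> - 1 < 0\<close>.\<close>
    assume "\<not> -1 < a"
    then have "a * (1 - \<delta>) \<le> -1 * (1 - \<delta>)" using d by (intro mult_right_mono) auto
    moreover have "0 < a + (1 - a) * \<delta>"
      using energy[of 1] bc S[of 1] by (metis add.right_neutral div_by_1 divide_pos_pos less_numeral_extra(1) order_refl)
    ultimately show False using d by (simp add: algebra_simps)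
  qed
  let ?X = "\<lambda>x. time_map \<epsilon> \<delta> a (1 + u x)"
  have u_ge: "\<delta> \<le> 1 + u x" if "x \<in> {0..1}" for x
    using u_incr[of x] that d by (cases "x = 0") auto
  \<comment> \<open>By the chain rule \<open>?X\<close> has derivative
    \<open>(1 / w') w' = 1\<close> inside the interval, so \<open>?X x - x\<close> is
    constant.\<close>
  have "?X 1 - 1 = ?X 0 - 0"
  proof (rule DERIV_isconst_end[of 0 1 "\<lambda>x. ?X x - x"])
    show "continuous_on {0..1} (\<lambda>x. ?X x - x)"
      by (intro continuous_intros continuous_on_compose2[OF continuous_on_time_map] cu)
        (use u_ge am1 d0 in auto)
  next
    fix x :: real assume x: "0 < x" "x < 1"
    define c where "c = a + (1 - a) * \<delta> / (1 + u x)"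
    have c: "c = 1 / S x" using energy[of x] x by (simp add: c_def)
    have p: "du x > 0" using du_pos x by blast
    have "1 - c\<^sup>2 = (S x * S x - 1) / (S x)\<^sup>2"
      using S[of x] by (simp add: c power2_eq_square field_simps)
    also have "\<dots> = (\<epsilon> * du x / S x)\<^sup>2"
      by (simp add: SS power_mult_distrib power_divide)
    finally have sc: "sqrt (1 - c\<^sup>2) = \<epsilon> * du x / S x"
      using S[of x] p e by simp
    have "(?X has_real_derivative \<epsilon> * (c / sqrt (1 - c\<^sup>2)) * du x) (at x)"
    proof (rule DERIV_chain2[where f = "time_map \<epsilon> \<delta> a" and g = "\<lambda>x. 1 + u x"])
      show "(time_map \<epsilon> \<delta> a has_real_derivative \<epsilon> * (c / sqrt (1 - c\<^sup>2))) (at (1 + u x))"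
        unfolding c_def using u_incr[of x] x d d0 am1 a1 by (intro time_map_has_derivative) auto
      show "((\<lambda>x. 1 + u x) has_real_derivative du x) (at x)"
        using DERIV_add[OF DERIV_const u'_at[OF x]] by simp
    qed
    from DERIV_diff[OF this DERIV_ident]
    have "((\<lambda>x. ?X x - x) has_real_derivative \<epsilon> * (c / sqrt (1 - c\<^sup>2)) * du x - 1) (at x)" .
    moreover have "\<epsilon> * (c / sqrt (1 - c\<^sup>2)) * du x = 1"
      unfolding sc using S[of x] p e by (simp add: c)
    ultimately show "((\<lambda>x. ?X x - x) has_real_derivative 0) (at x)"
      by (simp only: diff_self)
  qed simp
  then have "time_map \<epsilon> \<delta> a 1 = 1" using bc d d0 by simp
  moreover have "lam = \<delta> * (1 - a) / \<epsilon>\<^sup>2" using d0 e by (simp add: a_def)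
  ultimately show thesis using that am1 a1 by blast
qed

section \<open>From a root of the time map equation to a solution\<close>

text \<open>Used to pass from the parameter \<open>t\<close> back to \<open>x\<close>. Inverting on
  the whole line gives two-sided derivatives also at the endpoints 0 and 1.\<close>

lemma global_inverse_with_derivative:
  fixes f f' :: "real \<Rightarrow> real"
  assumes f': "\<And>t. (f has_real_derivative f' t) (at t)" and pos: "\<And>t. f' t > 0" and surj: "surj f"
  obtains g where "\<And>t. g (f t) = t" "\<And>x. (g has_real_derivative inverse (f' (g x))) (at x)"
proof -
  have "strict_mono f"
    by (rule strict_monoI, erule DERIV_pos_imp_increasing) (use f' pos in blast)
  then have "inj f" by (rule strict_mono_imp_inj_on)
  define g where "g = inv f"
  have gf: "g (f t) = t" for t using \<open>inj f\<close> by (simp add: g_def)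
  have fg: "f (g x) = x" for x using surj by (simp add: g_def surj_f_inv_f)
  have cf: "isCont f t" for t using f' by (rule DERIV_isCont)
  have "isCont g x" for x
    using isCont_inverse_function[of 1 "g x" g f] gf cf by (simp add: fg)
  then have "(g has_real_derivative inverse (f' (g x))) (at x)" for x
    by (intro DERIV_inverse_function[where f = f and a = "x - 1" and b = "x + 1"])
      (use f' pos fg in \<open>auto simp: less_imp_neq[symmetric]\<close>)
  with gf that show thesis by blast
qed

text \<open>The solution is written down parametrically and extends to all real \<open>x\<close>.
  Positivity of \<open>a\<close> keeps \<open>a * cosh t + 1\<close> positive for every
  \<open>t\<close>, so that \<open>x = f t\<close> is a bijection of the line.\<close>

lemma time_map_imp_on_branch:
  assumes e: "0 < \<epsilon>" and a: "0 < a" "a < 1" and d: "0 < \<delta>" "\<delta> < 1"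
    and tm: "time_map \<epsilon> \<delta> a 1 = 1"
  shows "on_branch \<epsilon> \<delta> (\<delta> * (1 - a) / \<epsilon>\<^sup>2)"
proof -
  define r where "r = sqrt (1 - a\<^sup>2)"
  have A: "0 < 1 - a\<^sup>2" using one_minus_square_pos a by simp
  then have r: "r > 0" "r * r = 1 - a\<^sup>2" by (simp_all add: r_def)
  define K where "K = \<epsilon> * \<delta> / ((1 + a) * r)"
  have K: "K > 0" using e d a r by (simp add: K_def)
  \<comment> \<open>In the parameter \<open>t = arcosh y\<close>, \<open>y\<close> as in \<open>time_map\<close>, both \<open>x = f t\<close> and \<open>w\<close> are elementary and smooth,
    also at the initial point \<open>t = 0\<close>, where \<open>x\<close> is not differentiable as a function of \<open>w\<close>.\<close>
  define f where "f = (\<lambda>t::real. K * (a * sinh t + t))"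
  define f' where "f' = (\<lambda>t::real. K * (a * cosh t + 1))"
  have ch: "a * cosh t + 1 > 0" "a + cosh t > 0" for t :: real
    using a by (auto intro!: add_pos_pos)
  have f': "(f has_real_derivative f' t) (at t)" for t
    unfolding f_def f'_def by (auto intro!: derivative_eq_intros)
  have "surj f"
  proof (rule surjI[of f "\<lambda>y. SOME t. f t = y"], rule someI_ex)
    fix y
    \<comment> \<open>\<open>f\<close> is odd and \<open>f b \<ge> K * b = \<bar>y\<bar>\<close>, so
      \<open>f\<close> takes the value \<open>y\<close> between \<open>-b\<close> and
      \<open>b\<close>.\<close>
    define b where "b = \<bar>y\<bar> / K"
    have b: "b \<ge> 0" "K * b = \<bar>y\<bar>" using K by (simp_all add: b_def)
    have "0 \<le> K * (a * sinh b)" using K a b by simp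
    then have "f (- b) \<le> y" "y \<le> f b"
      unfolding f_def using b by (auto simp: algebra_simps)
    moreover have "continuous_on {-b..b} f" using f' by (meson DERIV_continuous_on has_field_derivative_at_within)
    ultimately show "\<exists>t. f t = y" using IVT'[of f "-b" y b] b by auto
  qed
  then obtain g where gf: "\<And>t. g (f t) = t"
    and g': "\<And>x. (g has_real_derivative inverse (f' (g x))) (at x)"
    using global_inverse_with_derivative[of f f'] f' K ch by (auto simp: f'_def)
  define T where "T = arcosh ((1 + a) * 1 / \<delta> - a)"
  have y1: "1 \<le> (1 + a) * 1 / \<delta> - a"
    using mult_left_mono[of \<delta> 1 "1 + a"] a d by (simp add: field_simps)
  \<comment> \<open>\<open>sinh (arcosh y) = sqrt (y^2 - 1)\<close> turns \<open>f T\<close> into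
    the closed form, so the root condition says that \<open>x = 1\<close> is reached at
    \<open>t = T\<close>, where the height is 1.\<close>
  have "f T = time_map \<epsilon> \<delta> a 1"
    unfolding time_map_def Let_def f_def T_def K_def r_def using y1 by (simp only: sinh_arcosh_real)
  then have g1: "g 1 = T" using gf tm by metis
  have "f 0 = 0" by (simp add: f_def)
  then have g0: "g 0 = 0" using gf by metis
  \<comment> \<open>\<open>W\<close> is \<open>w\<close> solved from
    \<open>y = (1 + a) w / \<delta> - a\<close> with \<open>y = cosh t\<close>; \<open>P\<close> is
    dw/dx as the quotient of dw/dt and dx/dt, and \<open>P'\<close> is its derivative in
    \<open>t\<close>.\<close>
  define W where "W = (\<lambda>x. \<delta> / (1 + a) * (a + cosh (g x)))"
  define P where "P = (\<lambda>t. r / \<epsilon> * (sinh t / (a * cosh t + 1)))"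
  define P' where "P' = (\<lambda>t. r / \<epsilon> * ((a + cosh t) / (a * cosh t + 1)\<^sup>2))"
  define lam where "lam = \<delta> * (1 - a) / \<epsilon>\<^sup>2"
  have cg: "continuous_on s g" for s
    by (rule DERIV_continuous_on[OF has_field_derivative_at_within[OF g']])
  have W': "(W has_real_derivative P (g x)) (at x)" for x
  proof -
    have "((\<lambda>x. a + cosh (g x)) has_real_derivative sinh (g x) * inverse (f' (g x))) (at x)"
      by (auto intro!: derivative_eq_intros g')
    then have "(W has_real_derivative \<delta> / (1 + a) * (sinh (g x) * inverse (f' (g x)))) (at x)"
      unfolding W_def by (rule DERIV_cmult)
    also have "\<delta> / (1 + a) * (sinh (g x) * inverse (f' (g x)))
        = \<delta> / (1 + a) / K * (sinh (g x) / (a * cosh (g x) + 1))"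
      unfolding f'_def by (simp add: divide_inverse)
    also have "\<delta> / (1 + a) / K = r / \<epsilon>"
      using a e d r by (simp add: K_def)
    also have "r / \<epsilon> * (sinh (g x) / (a * cosh (g x) + 1)) = P (g x)"
      by (simp add: P_def)
    finally show ?thesis .
  qed
  have P': "(P has_real_derivative P' t) (at t)" for t
  proof -
    have "(P has_real_derivative r / \<epsilon> * ((cosh t * (a * cosh t + 1) - sinh t * (a * sinh t)) /
        ((a * cosh t + 1) * (a * cosh t + 1)))) (at t)"
    proof -
      have "((\<lambda>t. a * cosh t + 1) has_real_derivative a * sinh t) (at t)"
        "(sinh has_real_derivative cosh t) (at t)"
        by (auto intro!: derivative_eq_intros)
      then show ?thesis
        unfolding P_def using ch(1)[of t] by (intro DERIV_cmult DERIV_divide) auto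
    qed
    also have "cosh t * (a * cosh t + 1) - sinh t * (a * sinh t) = a * ((cosh t)\<^sup>2 - (sinh t)\<^sup>2) + cosh t"
      by (simp add: algebra_simps power2_eq_square)
    also have "\<dots> = a + cosh t" by (simp add: hyperbolic_pythagoras)
    finally show ?thesis by (simp add: P'_def power2_eq_square)
  qed
  have sqrtP: "P t / sqrt (1 + \<epsilon>\<^sup>2 * (P t)\<^sup>2) = r / \<epsilon> * (sinh t / (a + cosh t))" for t
  proof -
    let ?C = "cosh t" and ?c = "a * cosh t + 1"
    have "1 + \<epsilon>\<^sup>2 * (P t)\<^sup>2 = (?c\<^sup>2 + (r * r) * (sinh t)\<^sup>2) / ?c\<^sup>2"
    proof -
      have "\<epsilon>\<^sup>2 * (P t)\<^sup>2 = (r * sinh t / ?c)\<^sup>2"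
        using e by (simp add: P_def power_mult_distrib power_divide)
      then show ?thesis
        using ch(1)[of t] by (simp add: power_mult_distrib power_divide power2_eq_square[of r] add_divide_distrib)
    qed
    \<comment> \<open>A perfect square appears because \<open>r^2 = 1 - a^2\<close> and
      \<open>sinh^2 = cosh^2 - 1\<close>; the root in the equation thus becomes rational in
      \<open>cosh t\<close>.\<close>
    also have "?c\<^sup>2 + (r * r) * (sinh t)\<^sup>2 = (a + ?C)\<^sup>2"
      unfolding r(2) sinh_square_eq by (simp add: power2_eq_square algebra_simps)
    finally have "sqrt (1 + \<epsilon>\<^sup>2 * (P t)\<^sup>2) = (a + ?C) / ?c"
      using ch[of t] by (simp add: real_sqrt_divide)
    then show ?thesis using ch[of t] by (simp add: P_def)
  qed
  have ode: "((\<lambda>y. P (g y) / sqrt (1 + \<epsilon>\<^sup>2 * (P (g y))\<^sup>2)) has_real_derivative lam / (W x)\<^sup>2) (at x)" for x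
  proof -
    let ?t = "g x"
    have "((\<lambda>t. r / \<epsilon> * (sinh t / (a + cosh t))) has_real_derivative
       r / \<epsilon> * ((cosh ?t * (a + cosh ?t) - sinh ?t * sinh ?t) / ((a + cosh ?t) * (a + cosh ?t)))) (at ?t)"
    proof -
      have "((\<lambda>t. a + cosh t) has_real_derivative sinh ?t) (at ?t)"
        "(sinh has_real_derivative cosh ?t) (at ?t)"
        by (auto intro!: derivative_eq_intros)
      then show ?thesis
        using ch(2)[of ?t] by (intro DERIV_cmult DERIV_divide) auto
    qed
    also have "cosh ?t * (a + cosh ?t) - sinh ?t * sinh ?t = a * cosh ?t + ((cosh ?t)\<^sup>2 - (sinh ?t)\<^sup>2)"
      by (simp add: algebra_simps power2_eq_square)
    also have "\<dots> = a * cosh ?t + 1" by (simp add: hyperbolic_pythagoras)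
    finally have "((\<lambda>y. r / \<epsilon> * (sinh (g y) / (a + cosh (g y)))) has_real_derivative
      r / \<epsilon> * ((a * cosh ?t + 1) / ((a + cosh ?t) * (a + cosh ?t))) * inverse (f' ?t)) (at x)"
      by (rule DERIV_chain2[OF _ g'])
    \<comment> \<open>The factor \<open>a * cosh t + 1\<close> cancels against \<open>f'\<close>,
      leaving a constant over \<open>(a + cosh t)^2\<close>, which is proportional to
      \<open>1 / W^2\<close>.\<close>
    also have "r / \<epsilon> * ((a * cosh ?t + 1) / ((a + cosh ?t) * (a + cosh ?t))) * inverse (f' ?t)
       = r / (\<epsilon> * K) / (a + cosh ?t)\<^sup>2"
      using ch(1)[of ?t] by (simp add: f'_def power2_eq_square divide_simps)
    also have "r / (\<epsilon> * K) = (r * r) * (1 + a) / (\<epsilon>\<^sup>2 * \<delta>)"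
      using r a e d by (simp add: K_def power2_eq_square field_simps)
    also have "\<dots> = lam * (1 + a)\<^sup>2 / \<delta>\<^sup>2"
      unfolding r(2) lam_def using e d by (simp add: power2_eq_square field_simps)
    also have "lam * (1 + a)\<^sup>2 / \<delta>\<^sup>2 / (a + cosh ?t)\<^sup>2 = lam / (W x)\<^sup>2"
      using a d ch(2)[of ?t] by (simp add: W_def power_mult_distrib power_divide)
    finally show ?thesis by (simp add: sqrtP)
  qed
  have W0: "W x > 0" for x using ch(2)[of "g x"] a d by (simp add: W_def)
  have "is_solution \<epsilon> lam (\<lambda>x. W x - 1)"
    unfolding is_solution_def
  proof (intro conjI ballI;
      (rule exI[of _ "\<lambda>x. P (g x)"], rule exI[of _ "\<lambda>x. P' (g x) * inverse (f' (g x))"], intro conjI ballI)?)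
    show "0 < lam" using a d e by (simp add: lam_def)
    show "-1 < W x - 1" for x using W0[of x] by simp
    show "((\<lambda>x. W x - 1) has_real_derivative P (g x)) (at x within {0..1})" for x
      using DERIV_diff[OF W' DERIV_const] by (simp add: has_field_derivative_at_within)
    show Pg: "((\<lambda>x. P (g x)) has_real_derivative P' (g x) * inverse (f' (g x))) (at x)" for x
      by (rule DERIV_chain2[OF P' g'])
    show "continuous_on {0..1} (\<lambda>x. P (g x))"
      by (rule DERIV_continuous_on[OF has_field_derivative_at_within[OF Pg]])
    show "continuous_on {0<..<1} (\<lambda>x. P' (g x) * inverse (f' (g x)))"
      unfolding P'_def f'_def using ch(1) K e
      by (intro continuous_intros cg) (auto simp: less_imp_neq[symmetric])
    show "((\<lambda>y. P (g y) / sqrt (1 + \<epsilon>\<^sup>2 * (P (g y))\<^sup>2)) has_real_derivative lam / (1 + (W x - 1))\<^sup>2) (at x)" for x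
      using ode[of x] by simp
    show "P (g 0) = 0" by (simp add: g0 P_def)
    show "W 1 - 1 = 0"
      using y1 a d by (simp add: W_def g1 T_def)
  qed
  moreover have "1 + (W 0 - 1) = \<delta>" using a by (simp add: W_def g0 add.commute)
  ultimately show ?thesis unfolding on_branch_def lam_def by blast
qed

section \<open>Asymptotics of the time map at \<open>w = 1\<close> for trial parameters\<close>

text \<open>Taking \<open>(1 + a) / \<delta>\<close> out of \<open>sqrt (y^2 - 1)\<close> and
  writing \<open>arcosh\<close> as a logarithm isolates \<open>ln \<delta>\<close> as the only
  singular term when \<delta> tends to 0.\<close>

lemma time_map_at_1:
  assumes a: "-1 < a" "a < 1" and d: "0 < \<delta>" "\<delta> < 1"
  defines "R \<equiv> sqrt ((1 - \<delta>) * (1 + (1 - a) / (1 + a) * \<delta>))"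
  shows "time_map \<epsilon> \<delta> a 1 = \<epsilon> * (a / sqrt (1 - a\<^sup>2)) * R
     + \<epsilon> / ((1 + a) * sqrt (1 - a\<^sup>2)) * \<delta> * (ln (1 + a - a * \<delta> + (1 + a) * R) - ln \<delta>)"
proof -
  define y where "y = (1 + a) * 1 / \<delta> - a"
  have "(1 + a) * \<delta> \<le> (1 + a) * 1"
    using a d by (intro mult_left_mono) auto
  then have y1: "y \<ge> 1"
    using d by (simp add: y_def field_simps)
  have "(1 + a) * ((1 - a) / (1 + a)) = 1 - a"
    using a by simp
  moreover have "y - 1 = (1 + a) / \<delta> * (1 - \<delta>)"
    "(1 + a) / \<delta> * (1 + (1 - a) / (1 + a) * \<delta>) = (1 + a) / \<delta> + (1 + a) * ((1 - a) / (1 + a))"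
    using d by (simp_all add: y_def right_diff_distrib distrib_left)
  ultimately have "y - 1 = (1 + a) / \<delta> * (1 - \<delta>)" "y + 1 = (1 + a) / \<delta> * (1 + (1 - a) / (1 + a) * \<delta>)"
    by (simp_all add: y_def)
  moreover have "y\<^sup>2 - 1 = (y - 1) * (y + 1)"
    by (simp add: power2_eq_square algebra_simps)
  ultimately have "y\<^sup>2 - 1 = ((1 + a) / \<delta>)\<^sup>2 * ((1 - \<delta>) * (1 + (1 - a) / (1 + a) * \<delta>))"
    by (simp add: power2_eq_square)
  then have s: "sqrt (y\<^sup>2 - 1) = (1 + a) / \<delta> * R"
    using a d by (simp add: R_def real_sqrt_mult)
  have R0: "R \<ge> 0"
    using a d by (simp add: R_def)
  have "y + sqrt (y\<^sup>2 - 1) = (1 + a - a * \<delta> + (1 + a) * R) / \<delta>"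
    unfolding s using d by (simp add: y_def field_simps)
  moreover have "1 + a - a * \<delta> + (1 + a) * R > 0"
  proof -
    have "1 + a - a * \<delta> = (1 + a) * (1 - \<delta>) + \<delta>"
      by (simp add: algebra_simps)
    then show ?thesis
      using a d R0 by (simp add: add_pos_nonneg)
  qed
  ultimately have ar: "arcosh y = ln (1 + a - a * \<delta> + (1 + a) * R) - ln \<delta>"
    using y1 d by (simp add: arcosh_real_def ln_div)
  show ?thesis
    unfolding time_map_def Let_def y_def[symmetric] s ar
    using a d by (simp add: distrib_left)
qed

text \<open>Gives first-order expansions as exact identities with a slope continuous at the point,
  so that remainders can be treated by plain limits.\<close>

lemma caratheodory_at:
  fixes f :: "real \<Rightarrow> real"
  assumes "(f has_real_derivative D) (at x)"
  obtains g where "isCont g x" "g x = D" "\<And>z. f z - f x = g z * (z - x)"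
  using assms unfolding CARAT_DERIV by auto

text \<open>The leading term \<open>\<epsilon> a / sqrt (1 - a^2)\<close> equals 1 at
  \<open>a0\<close>, and its derivative there is \<open>1 / (a0 (1 - a0^2))\<close>. The correction
  in \<open>a \<delta>\<close> is chosen so that at order \<delta> the logarithms and the constants
  cancel, leaving only the effect of \<open>n\<close>.\<close>

lemma time_map_at_1_asymptotics:
  fixes \<epsilon> a0 n :: real
  assumes e: "0 < \<epsilon>" and a0: "0 < a0" "a0 < 1" and ea: "\<epsilon> * a0 = sqrt (1 - a0\<^sup>2)"
  defines "L \<equiv> ln (2 * (1 + a0)) - a0\<^sup>2"
  defines "a \<equiv> \<lambda>\<delta>. a0 + \<delta> * (n - (1 - a0) * (L - ln \<delta>))"
  shows "((\<lambda>\<delta>. (time_map \<epsilon> \<delta> (a \<delta>) 1 - 1) / \<delta>) \<longlongrightarrow> n / (a0 * (1 - a0\<^sup>2))) (at_right 0)"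
proof -
  define m where "m = 1 - a0"
  define k where "k = n - m * L"
  define s where "s = (\<lambda>\<delta>. \<delta> * (k + m * ln \<delta>))"
  have a_s: "a \<delta> = a0 + s \<delta>" for \<delta>
    by (simp add: a_def s_def k_def m_def algebra_simps)
  have s0: "(s \<longlongrightarrow> 0) (at_right 0)" unfolding s_def by real_asymp
  have sln: "((\<lambda>\<delta>. s \<delta> * ln \<delta>) \<longlongrightarrow> 0) (at_right 0)" unfolding s_def by real_asymp
  have s2: "((\<lambda>\<delta>. (s \<delta>)\<^sup>2 / \<delta>) \<longlongrightarrow> 0) (at_right 0)"
  proof -
    have "((\<lambda>\<delta>. k * s \<delta> + m * (s \<delta> * ln \<delta>)) \<longlongrightarrow> k * 0 + m * 0) (at_right 0)"
      by (intro tendsto_intros s0 sln)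
    \<comment> \<open>Since \<open>s \<delta> / \<delta> = k + m * ln \<delta>\<close>, the
      quadratic remainder divided by \<delta> is \<open>s\<close> times a logarithmic factor and
      still tends to 0.\<close>
    moreover have "\<forall>\<^sub>F \<delta> in at_right 0. k * s \<delta> + m * (s \<delta> * ln \<delta>) = (s \<delta>)\<^sup>2 / \<delta>"
      using eventually_at_right_less[of "0::real"]
      by eventually_elim (simp add: s_def power2_eq_square field_simps)
    ultimately show ?thesis
      by (simp add: tendsto_cong)
  qed
  have d0: "((\<lambda>\<delta>. \<delta>) \<longlongrightarrow> 0) (at_right (0::real))" by (rule tendsto_ident_at)
  have alim: "(a \<longlongrightarrow> a0) (at_right 0)"
    using tendsto_add[OF tendsto_const s0, of a0] by (simp add: a_s[abs_def])
  define A0 where "A0 = 1 - a0\<^sup>2"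
  have A0: "A0 > 0" using one_minus_square_pos a0 by (simp add: A0_def)
  define r where "r = (\<lambda>x::real. sqrt (1 - x\<^sup>2))"
  \<comment> \<open>\<open>h\<close> is the coefficient of the logarithmic term in the closed form.
    \<open>q\<close> is the difference quotient of \<open>\<epsilon> x / r x\<close> between
    \<open>x\<close> and \<open>a0\<close>, rationalised so that it makes sense at
    \<open>x = a0\<close>.\<close>
  define h where "h = (\<lambda>x. \<epsilon> / ((1 + x) * r x))"
  define q where "q = (\<lambda>x. \<epsilon> * (x + a0) / (r x * r a0 * (x * r a0 + a0 * r x)))"
  have r0: "r a0 > 0" "r a0 = sqrt A0" using A0 by (simp_all add: r_def A0_def)
  have dr: "(r has_real_derivative (- a0 / r a0)) (at a0)"
    unfolding r_def by (rule derivative_eq_intros refl | use A0 in \<open>simp add: A0_def field_simps\<close>)+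
  have rd: "r differentiable (at a0)" using dr real_differentiable_def by blast
  have "h differentiable (at a0)" "q differentiable (at a0)"
    unfolding h_def q_def
    by (intro differentiable_divide differentiable_mult differentiable_add
        differentiable_const differentiable_ident rd; use a0 r0 in simp)+
  then obtain Dh Dq where Dh: "(h has_real_derivative Dh) (at a0)" and Dq: "(q has_real_derivative Dq) (at a0)"
    unfolding real_differentiable_def by blast
  from Dh obtain h1 where h1: "isCont h1 a0" "\<And>z. h z - h a0 = h1 z * (z - a0)"
    by (rule caratheodory_at) blast
  from Dq obtain q1 where q1: "isCont q1 a0" "\<And>z. q z - q a0 = q1 z * (z - a0)"
    by (rule caratheodory_at) blast
  have rr: "r a0 * r a0 = A0" using r0 A0 by simp
  have ea': "\<epsilon> * a0 = r a0" using ea by (simp add: r_def)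
  have er: "\<epsilon> * (a0 / r a0) = 1"
    unfolding times_divide_eq_right ea' using r0 by simp
  have qa0: "q a0 = 1 / (a0 * A0)"
  proof -
    have "q a0 = \<epsilon> / (r a0 * (r a0 * r a0))" using a0 by (simp add: q_def field_simps)
    also have "\<dots> = (\<epsilon> * a0) / (r a0 * (a0 * A0))" using a0 by (simp add: rr)
    finally show ?thesis using r0 by (simp add: ea')
  qed
  have ha0: "h a0 = m * q a0"
  proof -
    have "h a0 = (\<epsilon> * a0) / (r a0 * (a0 * (1 + a0)))" using a0 by (simp add: h_def)
    also have "\<dots> = 1 / (a0 * (1 + a0))" using r0 by (simp add: ea')
    also have "\<dots> = m * q a0"
    proof -
      have "A0 = m * (1 + a0)" by (simp add: A0_def m_def power2_eq_square algebra_simps)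
      then show ?thesis using a0 by (simp add: qa0 m_def)
    qed
    finally show ?thesis .
  qed
  define v where "v = (\<lambda>\<delta>. (1 - a \<delta>) / (1 + a \<delta>))"
  define R where "R = (\<lambda>\<delta>. sqrt ((1 - \<delta>) * (1 + v \<delta> * \<delta>)))"
  have vlim: "(v \<longlongrightarrow> m / (1 + a0)) (at_right 0)"
    unfolding v_def m_def by (intro tendsto_intros alim) (use a0 in simp)
  have Rlim: "(R \<longlongrightarrow> 1) (at_right 0)"
  proof -
    have "(R \<longlongrightarrow> sqrt ((1 - 0) * (1 + m / (1 + a0) * 0))) (at_right 0)"
      unfolding R_def by (intro tendsto_intros vlim d0)
    then show ?thesis by simp
  qed
  have ev: "\<forall>\<^sub>F \<delta> in at_right 0. 0 < \<delta> \<and> \<delta> < 1 \<and> 0 < a \<delta> \<and> a \<delta> < 1"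
    using a0 by (auto intro!: eventually_conj order_tendstoD[OF alim] eventually_at_right_less
       order_tendstoD(2)[OF d0])
  \<comment> \<open>The \<open>ln \<delta>\<close> contributions of the second and third term cancel because \<open>h a0 = m * q a0\<close>.\<close>
  define T1 where "T1 = (\<lambda>\<delta>. \<epsilon> * (a \<delta> / r (a \<delta>)) * ((v \<delta> - 1 - v \<delta> * \<delta>) / (R \<delta> + 1)))"
  define T2 where "T2 = (\<lambda>\<delta>. q a0 * k + q1 (a \<delta>) * ((s \<delta>)\<^sup>2 / \<delta>))"
  define T3 where "T3 = (\<lambda>\<delta>. h (a \<delta>) * ln (1 + a \<delta> - a \<delta> * \<delta> + (1 + a \<delta>) * R \<delta>)
      - h1 (a \<delta>) * (s \<delta> * ln \<delta>))"
  have rlim: "((\<lambda>\<delta>. r (a \<delta>)) \<longlongrightarrow> r a0) (at_right 0)"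
    unfolding r_def by (intro tendsto_intros alim)
  have hlim: "((\<lambda>\<delta>. h (a \<delta>)) \<longlongrightarrow> h a0) (at_right 0)"
    unfolding h_def by (intro tendsto_intros alim rlim) (use a0 r0 in auto)
  have "(T1 \<longlongrightarrow> \<epsilon> * (a0 / r a0) * ((m / (1 + a0) - 1 - m / (1 + a0) * 0) / (1 + 1))) (at_right 0)"
    unfolding T1_def by (intro tendsto_intros alim vlim Rlim d0 rlim) (use r0 in auto)
  moreover have "\<epsilon> * (a0 / r a0) * ((m / (1 + a0) - 1 - m / (1 + a0) * 0) / (1 + 1)) = - (a0 / (1 + a0))"
  proof -
    show ?thesis unfolding er using a0 by (simp add: m_def field_simps)
  qed
  moreover have "(T2 \<longlongrightarrow> q a0 * k + q1 a0 * 0) (at_right 0)"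
    unfolding T2_def by (intro tendsto_intros isCont_tendsto_compose[OF q1(1)] alim s2)
  moreover have "(T3 \<longlongrightarrow> h a0 * ln (1 + a0 - a0 * 0 + (1 + a0) * 1) - h1 a0 * 0) (at_right 0)"
    unfolding T3_def
    by (intro tendsto_intros isCont_tendsto_compose[OF h1(1)] alim Rlim hlim sln d0) (use a0 in auto)
  ultimately have "((\<lambda>\<delta>. T1 \<delta> + T2 \<delta> + T3 \<delta>) \<longlongrightarrow>
      - (a0 / (1 + a0)) + (q a0 * k + q1 a0 * 0) + (h a0 * ln (1 + a0 - a0 * 0 + (1 + a0) * 1) - h1 a0 * 0)) (at_right 0)"
    by (intro tendsto_add) simp_all
  moreover have "- (a0 / (1 + a0)) + (q a0 * k + q1 a0 * 0) + (h a0 * ln (1 + a0 - a0 * 0 + (1 + a0) * 1) - h1 a0 * 0)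
      = n / (a0 * (1 - a0\<^sup>2))"
  proof -
    \<comment> \<open>The limit of \<open>T1\<close> is exactly what the summand
      \<open>- a0^2\<close> in \<open>L\<close> compensates; the other summand of \<open>L\<close>
      compensates the limit of \<open>T3\<close>.\<close>
    have "a0 / (1 + a0) = q a0 * m * a0\<^sup>2"
      using a0 A0 by (simp add: qa0 m_def A0_def field_simps power2_eq_square)
    then show ?thesis
      using a0 by (simp add: ha0 k_def L_def algebra_simps) (simp add: qa0 A0_def algebra_simps)
  qed
  moreover have "\<forall>\<^sub>F \<delta> in at_right 0. T1 \<delta> + T2 \<delta> + T3 \<delta> = (time_map \<epsilon> \<delta> (a \<delta>) 1 - 1) / \<delta>"
    using ev
  proof eventually_elim
    case (elim \<delta>)
    then have d: "0 < \<delta>" "\<delta> < 1" and ad: "0 < a \<delta>" "a \<delta> < 1" by auto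
    have rad: "r (a \<delta>) > 0" using one_minus_square_pos[of "a \<delta>"] ad by (simp add: r_def)
    have v0: "v \<delta> \<ge> 0" using ad by (simp add: v_def)
    have R2: "R \<delta> * R \<delta> = (1 - \<delta>) * (1 + v \<delta> * \<delta>)" and R0: "R \<delta> \<ge> 0"
      using d v0 by (simp_all add: R_def)
    \<comment> \<open>Multiplying \<open>R - 1\<close> by \<open>R + 1\<close> removes the square
      root and exposes a factor \<delta>, so \<open>(R - 1) / \<delta>\<close> has an evident
      limit.\<close>
    have "(v \<delta> - 1 - v \<delta> * \<delta>) * \<delta> = (R \<delta> - 1) * (R \<delta> + 1)"
      using R2 by (simp add: algebra_simps)
    then have RR: "(v \<delta> - 1 - v \<delta> * \<delta>) / (R \<delta> + 1) = (R \<delta> - 1) / \<delta>"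
      using d R0 by (simp add: divide_simps)
    have g: "\<epsilon> * (a \<delta> / r (a \<delta>)) - 1 = q (a \<delta>) * s \<delta>"
    proof -
      define b where "b = a \<delta>"
      have b: "0 < b" "r b > 0" using ad rad by (auto simp: b_def)
      have sb: "s \<delta> = b - a0" by (simp add: b_def a_s)
      have rb: "(r b)\<^sup>2 = 1 - b\<^sup>2" "(r a0)\<^sup>2 = 1 - a0\<^sup>2"
        using b r0 by (auto simp: r_def)
      \<comment> \<open>The conjugate factor clears the square roots and brings out
        \<open>b - a0\<close>; the number 1 is then written as
        \<open>\<epsilon> * (a0 / r a0)\<close>.\<close>
      have "(b * r a0 - a0 * r b) * (b * r a0 + a0 * r b) = b\<^sup>2 * (r a0)\<^sup>2 - a0\<^sup>2 * (r b)\<^sup>2"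
        by (simp add: algebra_simps power2_eq_square)
      also have "\<dots> = (b + a0) * (b - a0)"
        unfolding rb by (simp add: algebra_simps power2_eq_square)
      finally have 1: "(b * r a0 - a0 * r b) = (b + a0) * (b - a0) / (b * r a0 + a0 * r b)"
        using b a0 r0 by (simp add: add_pos_pos eq_divide_eq less_imp_neq[symmetric])
      have "\<epsilon> * (b / r b) - 1 = \<epsilon> * (b / r b) - \<epsilon> * (a0 / r a0)"
        by (simp only: er)
      also have "\<dots> = \<epsilon> * ((b * r a0 - a0 * r b) / (r b * r a0))"
        using b r0 by (simp add: field_simps)
      also have "\<dots> = q b * (b - a0)"
        unfolding 1 q_def by (simp add: mult_ac)
      finally show ?thesis by (simp add: sb b_def)
    qed
    have qs: "q (a \<delta>) * s \<delta> / \<delta> = T2 \<delta> + q a0 * m * ln \<delta>"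
    proof -
      have "q (a \<delta>) = q a0 + q1 (a \<delta>) * s \<delta>"
        using q1(2)[of "a \<delta>"] by (simp add: a_s)
      then have "q (a \<delta>) * s \<delta> / \<delta> = q a0 * (s \<delta> / \<delta>) + q1 (a \<delta>) * ((s \<delta>)\<^sup>2 / \<delta>)"
        by (simp add: power2_eq_square algebra_simps add_divide_distrib)
      also have "s \<delta> / \<delta> = k + m * ln \<delta>" using d by (simp add: s_def)
      finally show ?thesis by (simp add: T2_def algebra_simps)
    qed
    have hs: "h (a \<delta>) = h a0 + h1 (a \<delta>) * s \<delta>"
      using h1(2)[of "a \<delta>"] by (simp add: a_s)
    have tm1: "time_map \<epsilon> \<delta> (a \<delta>) 1 = \<epsilon> * (a \<delta> / r (a \<delta>)) * R \<delta>
     + h (a \<delta>) * \<delta> * (ln (1 + a \<delta> - a \<delta> * \<delta> + (1 + a \<delta>) * R \<delta>) - ln \<delta>)"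
      using time_map_at_1[of "a \<delta>" \<delta> \<epsilon>] d ad by (simp add: r_def h_def R_def v_def)
    \<comment> \<open>After division by \<delta> the three summands yield \<open>T1\<close>,
      \<open>T2\<close> and \<open>T3\<close>, up to the cancelling multiples of
      \<open>ln \<delta>\<close>.\<close>
    have "time_map \<epsilon> \<delta> (a \<delta>) 1 - 1 = \<epsilon> * (a \<delta> / r (a \<delta>)) * (R \<delta> - 1) + (\<epsilon> * (a \<delta> / r (a \<delta>)) - 1)
       + h (a \<delta>) * \<delta> * (ln (1 + a \<delta> - a \<delta> * \<delta> + (1 + a \<delta>) * R \<delta>) - ln \<delta>)"
      unfolding tm1 by (simp add: algebra_simps diff_divide_distrib)
    note tm = this[unfolded g]
    have "(x * y + z + v * \<delta> * w) / \<delta> = x * (y / \<delta>) + z / \<delta> + v * w" for x y z v w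
      using d by (simp add: add_divide_distrib)
    then have "(time_map \<epsilon> \<delta> (a \<delta>) 1 - 1) / \<delta> = T1 \<delta> + q (a \<delta>) * s \<delta> / \<delta>
     + h (a \<delta>) * (ln (1 + a \<delta> - a \<delta> * \<delta> + (1 + a \<delta>) * R \<delta>) - ln \<delta>)"
      unfolding tm T1_def RR .
    then show ?case
      unfolding qs T3_def hs ha0 by (simp add: algebra_simps)
  qed
  ultimately show ?thesis
    by (simp add: tendsto_cong)
qed

section \<open>Trapping the root, and the expansion of lambda\<close>

text \<open>The intermediate value theorem gives a root between the trial values, hence a solution.
  Any other solution also yields a root, and strict monotonicity in the parameter identifies the
  two, so the definite description is well defined.\<close>

lemma branch_lambda_between:
  assumes e: "0 < \<epsilon>" and d: "0 < \<delta>" "\<delta> < 1 / 2" and ab: "0 < lo" "lo \<le> hi" "hi < 1"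
    and tm: "time_map \<epsilon> \<delta> lo 1 \<le> 1" "1 \<le> time_map \<epsilon> \<delta> hi 1"
  obtains a where "lo \<le> a" "a \<le> hi" "\<exists>!lam. on_branch \<epsilon> \<delta> lam"
    "branch_lambda \<epsilon> \<delta> = \<delta> * (1 - a) / \<epsilon>\<^sup>2"
proof -
  have "continuous_on {lo..hi} (\<lambda>a. time_map \<epsilon> \<delta> a 1)"
    using d ab by (intro continuous_on_time_map_parameter) auto
  from IVT'[OF tm ab(2) this] obtain a where a: "lo \<le> a" "a \<le> hi" "time_map \<epsilon> \<delta> a 1 = 1"
    by blast
  have on: "on_branch \<epsilon> \<delta> (\<delta> * (1 - a) / \<epsilon>\<^sup>2)"
    using a ab d by (intro time_map_imp_on_branch[OF e]) auto
  have uniq: "lam = \<delta> * (1 - a) / \<epsilon>\<^sup>2" if "on_branch \<epsilon> \<delta> lam" for lam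
  proof -
    from that obtain u where "is_solution \<epsilon> lam u" "1 + u 0 = \<delta>"
      unfolding on_branch_def by blast
    from is_solution_imp_time_map[OF e this d(2)] obtain b
      where b: "-1 < b" "b < 1" "lam = \<delta> * (1 - b) / \<epsilon>\<^sup>2" "time_map \<epsilon> \<delta> b 1 = 1"
      by blast
    have "a = b"
      using time_map_strict_mono[OF e, of a b \<delta>] time_map_strict_mono[OF e, of b a \<delta>] a b ab d
      by (cases a b rule: linorder_cases) auto
    then show ?thesis using b by simp
  qed
  have ex1: "\<exists>!lam. on_branch \<epsilon> \<delta> lam" using on uniq by blast
  have "branch_lambda \<epsilon> \<delta> = \<delta> * (1 - a) / \<epsilon>\<^sup>2"
    unfolding branch_lambda_def using on uniq by (rule the_equality)
  with a ex1 that show thesis by blast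
qed

theorem mainTheorem1:
  fixes \<epsilon> :: real
  assumes "\<epsilon> > 0"
  shows "(\<forall>\<^sub>F \<delta> in at_right 0. \<exists>!lam. on_branch \<epsilon> \<delta> lam) \<and>
    (\<lambda>\<delta>. branch_lambda \<epsilon> \<delta> -
        (\<delta> * lambda1 \<epsilon> - \<delta>\<^sup>2 * ln \<delta> * lambda1 \<epsilon>
         + \<delta>\<^sup>2 * lambda1 \<epsilon> * (ln (4 - 2 * \<epsilon>\<^sup>2 * lambda1 \<epsilon>) - 1 / (1 + \<epsilon>\<^sup>2))))
      \<in> o[at_right 0](\<lambda>\<delta>. \<delta>\<^sup>2)"
proof -
  define \<rho> where "\<rho> = sqrt (1 + \<epsilon>\<^sup>2)"
  have \<rho>: "\<rho> > 1" "\<rho>\<^sup>2 = 1 + \<epsilon>\<^sup>2" using assms by (simp_all add: \<rho>_def)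
  \<comment> \<open>The positive root of \<open>\<epsilon> a = sqrt (1 - a^2)\<close>, the time map
    equation in the limit of vanishing \<delta>.\<close>
  define a0 where "a0 = 1 / \<rho>"
  have a0: "0 < a0" "a0 < 1" using \<rho> by (simp_all add: a0_def)
  have a02: "a0\<^sup>2 = 1 / (1 + \<epsilon>\<^sup>2)" by (simp add: a0_def power_divide \<rho>)
  have "1 - a0\<^sup>2 = (\<epsilon> * a0)\<^sup>2"
  proof -
    have "1 + \<epsilon>\<^sup>2 \<noteq> 0" using \<rho> by (metis not_one_less_zero zero_eq_power2)
    then show ?thesis unfolding power_mult_distrib a02 by (simp add: field_simps)
  qed
  then have ea: "\<epsilon> * a0 = sqrt (1 - a0\<^sup>2)" using a0 assms by simp
  have l1: "lambda1 \<epsilon> = (1 - a0) / \<epsilon>\<^sup>2"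
  proof -
    have "lambda1 \<epsilon> = ((\<rho> - 1) / \<rho>) / \<epsilon>\<^sup>2"
      by (simp add: lambda1_def \<rho>_def)
    also have "(\<rho> - 1) / \<rho> = 1 - a0" using \<rho> by (simp add: a0_def diff_divide_distrib)
    finally show ?thesis .
  qed
  define L where "L = ln (2 * (1 + a0)) - a0\<^sup>2"
  have L: "ln (4 - 2 * \<epsilon>\<^sup>2 * lambda1 \<epsilon>) - 1 / (1 + \<epsilon>\<^sup>2) = L"
  proof -
    have "4 - 2 * \<epsilon>\<^sup>2 * lambda1 \<epsilon> = 2 * (1 + a0)" using assms by (simp add: l1)
    then show ?thesis by (simp only: L_def a02)
  qed
  \<comment> \<open>For \<open>n = 0\<close>,
    \<open>\<delta> * (1 - \<alpha> 0 \<delta>) / \<epsilon>^2\<close> is exactly the claimed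
    three-term expression; \<open>n\<close> shifts the parameter at order \<delta>.\<close>
  define \<alpha> where "\<alpha> = (\<lambda>n \<delta>. a0 + \<delta> * (n - (1 - a0) * (L - ln \<delta>)))"
  have main: "\<forall>\<^sub>F \<delta> in at_right 0. 0 < \<delta> \<and> (\<exists>!lam. on_branch \<epsilon> \<delta> lam) \<and>
      (\<exists>a. \<alpha> (- n) \<delta> \<le> a \<and> a \<le> \<alpha> n \<delta> \<and> branch_lambda \<epsilon> \<delta> = \<delta> * (1 - a) / \<epsilon>\<^sup>2)"
    if n: "n > 0" for n
  proof -
    have lim: "((\<lambda>\<delta>. (time_map \<epsilon> \<delta> (\<alpha> k \<delta>) 1 - 1) / \<delta>) \<longlongrightarrow> k / (a0 * (1 - a0\<^sup>2))) (at_right 0)" for k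
      unfolding \<alpha>_def L_def by (rule time_map_at_1_asymptotics[OF assms a0 ea])
    have pos: "a0 * (1 - a0\<^sup>2) > 0" using one_minus_square_pos[of a0] a0 by simp
    have \<alpha>lim: "(\<alpha> k \<longlongrightarrow> a0) (at_right 0)" for k
      unfolding \<alpha>_def by real_asymp
    have "\<forall>\<^sub>F \<delta> in at_right 0. (time_map \<epsilon> \<delta> (\<alpha> (- n) \<delta>) 1 - 1) / \<delta> < 0"
      using lim by (rule order_tendstoD) (use n pos in \<open>simp add: divide_neg_pos\<close>)
    moreover have "\<forall>\<^sub>F \<delta> in at_right 0. 0 < (time_map \<epsilon> \<delta> (\<alpha> n \<delta>) 1 - 1) / \<delta>"
      using lim by (rule order_tendstoD) (use n pos in simp)
    moreover have "\<forall>\<^sub>F \<delta> in at_right 0. 0 < \<alpha> (- n) \<delta>" "\<forall>\<^sub>F \<delta> in at_right 0. \<alpha> n \<delta> < 1"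
      using order_tendstoD[OF \<alpha>lim] a0 by blast+
    moreover have "\<forall>\<^sub>F \<delta> in at_right (0::real). 0 < \<delta>" "\<forall>\<^sub>F \<delta> in at_right (0::real). \<delta> < 1 / 2"
      by real_asymp+
    ultimately show ?thesis
    proof eventually_elim
      case (elim \<delta>)
      have "\<delta> * n > 0" using elim n by simp
      then have "\<alpha> (- n) \<delta> \<le> \<alpha> n \<delta>"
        by (simp add: \<alpha>_def algebra_simps)
      moreover have "time_map \<epsilon> \<delta> (\<alpha> (- n) \<delta>) 1 \<le> 1" "1 \<le> time_map \<epsilon> \<delta> (\<alpha> n \<delta>) 1"
        using elim by (simp_all add: zero_less_divide_iff divide_less_0_iff)
      ultimately obtain a where "\<alpha> (- n) \<delta> \<le> a" "a \<le> \<alpha> n \<delta>" "\<exists>!lam. on_branch \<epsilon> \<delta> lam"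
        "branch_lambda \<epsilon> \<delta> = \<delta> * (1 - a) / \<epsilon>\<^sup>2"
        using branch_lambda_between[OF assms, of \<delta> "\<alpha> (- n) \<delta>" "\<alpha> n \<delta>"] elim by blast
      then show ?case using elim by blast
    qed
  qed
  show ?thesis
  proof
    show "\<forall>\<^sub>F \<delta> in at_right 0. \<exists>!lam. on_branch \<epsilon> \<delta> lam"
      using main[OF zero_less_one] by eventually_elim blast
  next
    show "(\<lambda>\<delta>. branch_lambda \<epsilon> \<delta> - (\<delta> * lambda1 \<epsilon> - \<delta>\<^sup>2 * ln \<delta> * lambda1 \<epsilon>
         + \<delta>\<^sup>2 * lambda1 \<epsilon> * (ln (4 - 2 * \<epsilon>\<^sup>2 * lambda1 \<epsilon>) - 1 / (1 + \<epsilon>\<^sup>2))))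
      \<in> o[at_right 0](\<lambda>\<delta>. \<delta>\<^sup>2)"
      unfolding L
    proof (rule landau_o.smallI)
      fix c :: real assume c: "c > 0"
      \<comment> \<open>An error of at most \<open>\<delta> * n\<close> in \<open>a\<close> becomes
        \<open>\<delta>^2 * n / \<epsilon>^2\<close> in lambda, which is
        \<open>c * \<delta>^2\<close> for this \<open>n\<close>.\<close>
      define n where "n = c * \<epsilon>\<^sup>2"
      have n: "n > 0" using c assms by (simp add: n_def)
      show "\<forall>\<^sub>F \<delta> in at_right 0. norm (branch_lambda \<epsilon> \<delta> - (\<delta> * lambda1 \<epsilon> - \<delta>\<^sup>2 * ln \<delta> * lambda1 \<epsilon>
         + \<delta>\<^sup>2 * lambda1 \<epsilon> * L)) \<le> c * norm (\<delta>\<^sup>2)"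
        using main[OF n]
      proof eventually_elim
        case (elim \<delta>)
        then obtain a where a: "\<alpha> (- n) \<delta> \<le> a" "a \<le> \<alpha> n \<delta>"
          "branch_lambda \<epsilon> \<delta> = \<delta> * (1 - a) / \<epsilon>\<^sup>2" and d: "\<delta> > 0" by blast
        have "\<bar>\<alpha> 0 \<delta> - a\<bar> \<le> \<delta> * n"
          using a by (auto simp: \<alpha>_def algebra_simps abs_le_iff)
        have "branch_lambda \<epsilon> \<delta> - (\<delta> * lambda1 \<epsilon> - \<delta>\<^sup>2 * ln \<delta> * lambda1 \<epsilon> + \<delta>\<^sup>2 * lambda1 \<epsilon> * L)
            = \<delta> / \<epsilon>\<^sup>2 * (\<alpha> 0 \<delta> - a)"
          using assms by (simp add: a(3) l1 \<alpha>_def field_simps power2_eq_square)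
        also have "norm \<dots> \<le> \<delta> / \<epsilon>\<^sup>2 * (\<delta> * n)"
          unfolding real_norm_def abs_mult using d \<open>\<bar>\<alpha> 0 \<delta> - a\<bar> \<le> \<delta> * n\<close>
          by (intro mult_mono) auto
        also have "\<dots> = c * norm (\<delta>\<^sup>2)"
          using assms by (simp add: n_def power2_eq_square)
        finally show ?case .
      qed
    qed
  qed
qed

end
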